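(* For any real $\varepsilon > 0$ there is an integer $k_0$ such that for every integer $k \ge k_0$ we have $\Phi(K_k \,\square\, K_2) < \varepsilon\, k!$.
   Context: All graphs are finite and simple. $\Phi(G)$ denotes the number of perfect matchings of a graph $G$. $K_k$ is the complete graph on $k$ vertices. The Cartesian product $G \,\square\, H$ of graphs $G$ and $H$ is the graph with vertex set $V(G)\times V(H)$ in which $(v,w)$ and $(v',w')$ are adjacent if either $v=v'$ and $ww' \in E(H)$, or $w=w'$ and $vv' \in E(G)$. *)

theory Defs
  imports Complex_Main
begin

record 'a ugraph =
  verts :: "'a set"
  edges :: "'a set set"

locale simple_graph =
  fixes G :: "'a ugraph"
  assumes finite_verts: "finite (verts G)"
    and edge_subset: "e \<in> edges G \<Longrightarrow> e \<subseteq> verts G"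
    and edge_card: "e \<in> edges G \<Longrightarrow> card e = 2"

definition complete_graph :: "nat \<Rightarrow> nat ugraph" where
  "complete_graph k = \<lparr>verts = {..<k}, edges = {e. e \<subseteq> {..<k} \<and> card e = 2}\<rparr>"

definition cartesian_product :: "'a ugraph \<Rightarrow> 'b ugraph \<Rightarrow> ('a \<times> 'b) ugraph"
    (infixl "\<box>" 70) where
  "G \<box> H = \<lparr>verts = verts G \<times> verts H,
     edges = {{(v, w), (v', w')} | v w v' w'.
       v \<in> verts G \<and> v' \<in> verts G \<and> w \<in> verts H \<and> w' \<in> verts H \<and>
       (v = v' \<and> {w, w'} \<in> edges H \<or> w = w' \<and> {v, v'} \<in> edges G)}\<rparr>"

definition perfect_matching :: "'a ugraph \<Rightarrow> 'a set set \<Rightarrow> bool" where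
  "perfect_matching G M \<longleftrightarrow> M \<subseteq> edges G \<and> (\<forall>v \<in> verts G. \<exists>!e. e \<in> M \<and> v \<in> e)"

definition num_perfect_matchings :: "'a ugraph \<Rightarrow> nat" ("\<Phi>") where
  "\<Phi> G = card {M. perfect_matching G M}"

lemma simple_graph_complete_graph: "simple_graph (complete_graph k)"
  by unfold_locales (auto simp: complete_graph_def)

lemma adjacent_cartesian_product:
  "{(v, w), (v', w')} \<in> edges (G \<box> H) \<longleftrightarrow>
     v \<in> verts G \<and> v' \<in> verts G \<and> w \<in> verts H \<and> w' \<in> verts H \<and>
     (v = v' \<and> {w, w'} \<in> edges H \<or> w = w' \<and> {v, v'} \<in> edges G)"
  by (auto simp: cartesian_product_def doubleton_eq_iff insert_commute)

lemma simple_graph_cartesian_product: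
  assumes "simple_graph G" "simple_graph H"
  shows "simple_graph (G \<box> H)"
proof
  interpret G: simple_graph G by fact
  interpret H: simple_graph H by fact
  show "finite (verts (G \<box> H))"
    by (simp add: cartesian_product_def G.finite_verts H.finite_verts)
  fix e assume e: "e \<in> edges (G \<box> H)"
  then show "e \<subseteq> verts (G \<box> H)"
    by (auto simp: cartesian_product_def)
  have "{x} \<notin> edges G" "{y} \<notin> edges H" for x y
    using G.edge_card[of "{x}"] H.edge_card[of "{y}"] by auto
  with e show "card e = 2"
    by (auto simp: cartesian_product_def card_insert_if)
qed

lemma (in simple_graph) finite_perfect_matchings: "finite {M. perfect_matching G M}"
proof -
  have "edges G \<subseteq> Pow (verts G)" using edge_subset by blast
  then have "finite (edges G)" using finite_verts by (simp add: finite_subset)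
  then show ?thesis
    by (rule finite_subset[rotated, OF finite_Pow_iff[THEN iffD2]])
      (auto simp: perfect_matching_def)
qed

end

theory Submission
  imports Defs
begin

text \<open>
  The prism \<open>K\<^sub>k \<box> K\<^sub>2\<close> consists of two copies of \<open>K\<^sub>k\<close>, the levels, joined by \<open>k\<close> rungs. A perfect
  matching is determined by the set \<open>T\<close> of columns whose rung it does not use, together with the
  perfect matchings that it induces on the two copies of \<open>T\<close>
  (\<open>perfect_matching_level\<close>, \<open>inj_on_split_matching\<close>). If \<open>i n\<close> is the number of ways to pair off
  \<open>n\<close> points, then the number of perfect matchings is at most the sum of
  \<open>(k choose j) * i(k - j)\<^sup>2\<close> over the number \<open>j\<close> of rungs used.

  Each term is at most \<open>k! / j!\<close> times \<open>i(k - j)\<^sup>2 / (k - j)!\<close>. For even \<open>n\<close> the ratio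
  \<open>i(n)\<^sup>2 / n!\<close> is the product of the odd numbers below \<open>n\<close> divided by the product of the even
  numbers up to \<open>n\<close>, and for odd \<open>n\<close> it is zero; in either case it is at most
  \<open>1 / sqrt (n + 1)\<close> (\<open>pairings_sq_le\<close>). Because of the factor \<open>1 / j!\<close>, only terms with few
  rungs matter, and there \<open>k - j\<close> is close to \<open>k\<close>. The explicit form of this is that replacing
  \<open>1 / sqrt (k - j + 1)\<close> by \<open>1 / sqrt (k + 1)\<close> costs at most a factor \<open>2\<^sup>j\<close>
  (\<open>inverse_sqrt_split_le\<close>), which the sum absorbs: \<open>2\<^sup>j / j!\<close> adds up to at most \<open>exp 2\<close>.
  Hence the number of perfect matchings is at most \<open>exp 2 / sqrt (k + 1)\<close> times \<open>k!\<close>.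
\<close>

section \<open>Perfect matchings of a complete graph\<close>

definition complete_on :: "'a set \<Rightarrow> 'a ugraph" where
  "complete_on S = \<lparr>verts = S, edges = {e. e \<subseteq> S \<and> card e = 2}\<rparr>"

abbreviation matchings_on :: "'a set \<Rightarrow> 'a set set set" where
  "matchings_on S \<equiv> {M. perfect_matching (complete_on S) M}"

lemma perfect_matching_complete_on:
  "perfect_matching (complete_on S) M \<longleftrightarrow>
     (\<forall>e\<in>M. e \<subseteq> S \<and> card e = 2) \<and> (\<forall>v\<in>S. \<exists>!e. e \<in> M \<and> v \<in> e)"
  by (auto simp: perfect_matching_def complete_on_def)

lemma finite_matchings_on:
  assumes "finite S"
  shows "finite (matchings_on S)"
proof -
  have "matchings_on S \<subseteq> Pow (Pow S)"
    by (auto simp: perfect_matching_complete_on)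
  with assms show ?thesis
    by (meson finite_Pow_iff finite_subset)
qed

text \<open>The double factorial \<open>(n - 1)!!\<close> for even \<open>n\<close>, and zero for odd \<open>n\<close>: the number of ways to
  partition \<open>n\<close> points into pairs.\<close>

fun pairings :: "nat \<Rightarrow> nat" where
  "pairings 0 = 1"
| "pairings (Suc 0) = 0"
| "pairings (Suc (Suc n)) = Suc n * pairings n"

text \<open>The recursion behind the double factorial: a fixed vertex \<open>a\<close> is matched to some \<open>b\<close>, and
  deleting the edge \<open>{a, b}\<close> leaves a perfect matching on the other vertices.\<close>

lemma matchings_on_remove_partner:
  assumes "a \<in> S"
  shows "matchings_on S \<subseteq> (\<Union>b\<in>S - {a}. insert {a, b} ` matchings_on (S - {a, b}))"
proof
  fix M assume "M \<in> matchings_on S"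
  then have edge: "\<And>e. e \<in> M \<Longrightarrow> e \<subseteq> S \<and> card e = 2"
    and ex1: "\<And>v. v \<in> S \<Longrightarrow> \<exists>!e. e \<in> M \<and> v \<in> e"
    by (auto simp: perfect_matching_complete_on)
  obtain e where e: "e \<in> M" "a \<in> e"
    using ex1[OF assms] by blast
  obtain b where b: "e = {a, b}" "b \<noteq> a"
    using edge[OF e(1)] e(2) by (auto simp: card_2_iff)
  have bS: "b \<in> S - {a}"
    using edge[OF e(1)] b by auto
  have disj: "d \<inter> {a, b} = {}" if "d \<in> M" "d \<noteq> e" for d
    using ex1[OF assms] ex1[of b] bS that e b by blast
  have "perfect_matching (complete_on (S - {a, b})) (M - {e})"
    unfolding perfect_matching_complete_on
  proof (intro conjI ballI)
    fix d assume "d \<in> M - {e}"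
    then show "d \<subseteq> S - {a, b}" "card d = 2"
      using edge[of d] disj[of d] by auto
  next
    fix v assume v: "v \<in> S - {a, b}"
    then have "\<exists>!d. d \<in> M \<and> v \<in> d" "v \<notin> e"
      using ex1[of v] b by auto
    then show "\<exists>!d. d \<in> M - {e} \<and> v \<in> d"
      by (metis DiffE DiffI singletonD)
  qed
  moreover have "M = insert {a, b} (M - {e})"
    using e b by auto
  ultimately show "M \<in> (\<Union>b\<in>S - {a}. insert {a, b} ` matchings_on (S - {a, b}))"
    using bS by blast
qed

lemma card_matchings_on_le:
  "finite S \<Longrightarrow> card S = n \<Longrightarrow> card (matchings_on S) \<le> pairings n"
proof (induction n arbitrary: S rule: pairings.induct)
  case 1
  then have "matchings_on S \<subseteq> {{}}"
    by (auto simp: perfect_matching_complete_on)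
  then show ?case
    using card_mono[of "{{}}" "matchings_on S"] by simp
next
  case 2
  then obtain x where "S = {x}"
    by (metis One_nat_def card_1_singletonE)
  moreover have "e \<subseteq> {x} \<Longrightarrow> card e \<noteq> 2" for e
    using card_mono[of "{x}" e] by auto
  ultimately have "matchings_on S = {}"
    by (auto simp: perfect_matching_complete_on)
  then show ?case by simp
next
  case (3 n)
  then obtain a where a: "a \<in> S"
    by (metis card.empty ex_in_conv nat.distinct(1))
  have fin: "finite (matchings_on (S - {a, b}))" for b
    using 3 by (intro finite_matchings_on) auto
  have "card (matchings_on S)
      \<le> card (\<Union>b\<in>S - {a}. insert {a, b} ` matchings_on (S - {a, b}))"
    using 3 fin by (intro card_mono matchings_on_remove_partner[OF a]) auto
  also have "\<dots> \<le> (\<Sum>b\<in>S - {a}. card (insert {a, b} ` matchings_on (S - {a, b})))"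
    using 3 by (intro card_UN_le) auto
  also have "\<dots> \<le> (\<Sum>b\<in>S - {a}. pairings n)"
  proof (intro sum_mono)
    fix b assume b: "b \<in> S - {a}"
    have "card (S - {a, b}) = n"
      using 3 a b by (subst card_Diff_subset) auto
    then have "card (matchings_on (S - {a, b})) \<le> pairings n"
      using 3 by auto
    then show "card (insert {a, b} ` matchings_on (S - {a, b})) \<le> pairings n"
      using card_image_le[OF fin, of "insert {a, b}" b] by linarith
  qed
  also have "\<dots> = pairings (Suc (Suc n))"
    using 3 a by simp
  finally show ?case .
qed

text \<open>The fourth power makes the bound \<open>i(n)\<^sup>2 \<le> n! / sqrt (n + 1)\<close> a statement about natural numbers.
  In the step from \<open>n\<close> to \<open>n + 2\<close> the claim reduces to \<open>(n + 1) (n + 3) \<le> (n + 2)\<^sup>2\<close>.\<close>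

lemma pairings_pow4_le: "Suc n * pairings n ^ 4 \<le> fact n ^ 2"
proof (induction n rule: pairings.induct)
  case (3 n)
  \<comment> \<open>The extra factor \<open>Suc n\<close>, cancelled at the end, is what the induction hypothesis needs.\<close>
  have "Suc n * (Suc (Suc (Suc n)) * pairings (Suc (Suc n)) ^ 4)
      = (Suc n * Suc (Suc (Suc n))) * (Suc n) ^ 4 * pairings n ^ 4"
    by (simp add: power_mult_distrib del: mult_Suc mult_Suc_right)
  also have "\<dots> \<le> Suc (Suc n) ^ 2 * (Suc n) ^ 4 * pairings n ^ 4"
    by (intro mult_right_mono) (auto simp: power2_eq_square)
  also have "\<dots> = Suc (Suc n) ^ 2 * (Suc n) ^ 3 * (Suc n * pairings n ^ 4)"
    by (simp add: eval_nat_numeral del: mult_Suc mult_Suc_right)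
  also have "\<dots> \<le> Suc (Suc n) ^ 2 * (Suc n) ^ 3 * fact n ^ 2"
    using 3 by (intro mult_left_mono) auto
  also have "\<dots> = Suc n * (fact (Suc (Suc n))) ^ 2"
    by (simp add: eval_nat_numeral del: mult_Suc mult_Suc_right)
  finally show ?case
    by (simp only: mult_le_cancel1)
qed auto

lemma pairings_sq_le: "real (pairings n) ^ 2 \<le> fact n / sqrt (real n + 1)"
proof (rule power2_le_imp_le)
  have "real (Suc n * pairings n ^ 4) \<le> real (fact n ^ 2)"
    using pairings_pow4_le of_nat_le_iff by blast
  then show "(real (pairings n) ^ 2) ^ 2 \<le> (fact n / sqrt (real n + 1)) ^ 2"
    by (simp add: power_divide field_simps flip: power_mult)
qed simp

section \<open>Perfect matchings of the prism over a complete graph\<close>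

definition rung :: "nat \<Rightarrow> (nat \<times> nat) set" where
  "rung v = {(v, 0), (v, 1)}"

definition lift_edge :: "nat \<Rightarrow> nat set \<Rightarrow> (nat \<times> nat) set" where
  "lift_edge i d = (\<lambda>v. (v, i)) ` d"

lemma mem_rung: "(u, i) \<in> rung v \<longleftrightarrow> u = v \<and> (i = 0 \<or> i = 1)"
  by (auto simp: rung_def)

lemma mem_lift_edge: "(u, j) \<in> lift_edge i d \<longleftrightarrow> u \<in> d \<and> j = i"
  by (auto simp: lift_edge_def)

lemma lift_edge_inject: "lift_edge i d = lift_edge i d' \<longleftrightarrow> d = d'"
  unfolding lift_edge_def by (rule inj_image_eq_iff) (auto intro: injI)

lemma prism_edge_cases:
  assumes "e \<in> edges (complete_graph k \<box> complete_graph 2)"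
  obtains (rung) v where "v < k" "e = rung v"
  | (level) i d where "i < 2" "d \<subseteq> {..<k}" "card d = 2" "e = lift_edge i d"
proof -
  obtain v w v' w' where e: "e = {(v, w), (v', w')}" and
    lt: "v < k" "v' < k" "w < 2" "w' < 2" and
    adj: "v = v' \<and> card {w, w'} = 2 \<or> w = w' \<and> card {v, v'} = 2"
    using assms by (auto simp: cartesian_product_def complete_graph_def)
  from adj show ?thesis
  proof
    assume *: "v = v' \<and> card {w, w'} = 2"
    then have "w \<noteq> w'" by auto
    with lt have "w = 0 \<and> w' = 1 \<or> w = 1 \<and> w' = 0" by auto
    then show ?thesis using * e lt rung[of v] by (auto simp: rung_def)
  next
    assume "w = w' \<and> card {v, v'} = 2"
    then show ?thesis using e lt level[of w "{v, v'}"] by (auto simp: lift_edge_def)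
  qed
qed

text \<open>The columns without a rung in \<open>M\<close>, and the traces of \<open>M\<close> on the two levels.\<close>

definition split_matching ::
    "nat \<Rightarrow> (nat \<times> nat) set set \<Rightarrow> nat set \<times> nat set set \<times> nat set set" where
  "split_matching k M =
     ({v. v < k \<and> rung v \<notin> M}, {d. lift_edge 0 d \<in> M}, {d. lift_edge 1 d \<in> M})"

text \<open>A level edge of \<open>M\<close> cannot touch a column whose rung lies in \<open>M\<close>, since the common vertex would
  be covered twice; conversely, a vertex in a column without a rung can only be covered by an edge
  of its own level.\<close>

lemma perfect_matching_level:
  assumes M: "perfect_matching (complete_graph k \<box> complete_graph 2) M" and i: "i < 2"
  shows "perfect_matching (complete_on {v. v < k \<and> rung v \<notin> M}) {d. lift_edge i d \<in> M}"
proof -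
  let ?T = "{v. v < k \<and> rung v \<notin> M}"
  have sub: "\<And>e. e \<in> M \<Longrightarrow> e \<in> edges (complete_graph k \<box> complete_graph 2)"
    and ex1: "\<And>v. v < k \<Longrightarrow> \<exists>!e. e \<in> M \<and> (v, i) \<in> e"
    using M i by (auto simp: perfect_matching_def complete_graph_def cartesian_product_def)
  have i01: "i = 0 \<or> i = 1" using i by auto
  \<comment> \<open>The rung also contains a vertex on the opposite level \<open>1 - i\<close>.\<close>
  have not_rung: "lift_edge i d \<noteq> rung u" for d u
    using mem_lift_edge[of u "1 - i" i d] mem_rung[of u "1 - i" u] i01 by auto
  show ?thesis
    unfolding perfect_matching_complete_on
  proof (intro conjI ballI)
    fix d assume "d \<in> {d. lift_edge i d \<in> M}"
    then have dM: "lift_edge i d \<in> M" by simp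
    have d: "d \<subseteq> {..<k} \<and> card d = 2"
      using sub[OF dM]
    proof (cases rule: prism_edge_cases)
      case (rung v)
      then show ?thesis using not_rung by simp
    next
      case (level j d')
      then obtain u where u: "u \<in> d'" by fastforce
      then have "j = i"
        using level(4) mem_lift_edge[of u j i d] mem_lift_edge[of u j j d'] by simp
      then show ?thesis using level lift_edge_inject by simp
    qed
    then show "card d = 2" by simp
    show "d \<subseteq> ?T"
    proof
      fix u assume u: "u \<in> d"
      then have "u < k" using d by auto
      moreover have "rung u \<notin> M"
      proof
        assume "rung u \<in> M"
        moreover have "(u, i) \<in> rung u" "(u, i) \<in> lift_edge i d"
          using u i01 by (simp_all add: mem_rung mem_lift_edge)
        ultimately have "lift_edge i d = rung u"
          using ex1[OF \<open>u < k\<close>] dM by blast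
        then show False using not_rung by simp
      qed
      ultimately show "u \<in> ?T" by simp
    qed
  next
    fix v assume v: "v \<in> ?T"
    then obtain e where e: "e \<in> M" "(v, i) \<in> e"
      and uniq: "\<And>e'. e' \<in> M \<Longrightarrow> (v, i) \<in> e' \<Longrightarrow> e' = e"
      using ex1[of v] by blast
    from sub[OF e(1)] obtain d where d: "e = lift_edge i d"
    proof (cases rule: prism_edge_cases)
      case (rung u)
      then show ?thesis using e v by (auto simp: mem_rung)
    next
      case (level j d)
      then show ?thesis using e that by (auto simp: mem_lift_edge)
    qed
    show "\<exists>!d. d \<in> {d. lift_edge i d \<in> M} \<and> v \<in> d"
    proof (rule ex1I[of _ d])
      show "d \<in> {d. lift_edge i d \<in> M} \<and> v \<in> d"
        using e d by (auto simp: mem_lift_edge)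
      fix d' assume "d' \<in> {d. lift_edge i d \<in> M} \<and> v \<in> d'"
      then show "d' = d"
        using uniq[of "lift_edge i d'"] d by (auto simp: mem_lift_edge lift_edge_inject)
    qed
  qed
qed

text \<open>Every edge of the prism is a rung or lies on one of the two levels, and the splitting records
  for each such edge whether it belongs to the matching.\<close>

lemma inj_on_split_matching:
  "inj_on (split_matching k) {M. perfect_matching (complete_graph k \<box> complete_graph 2) M}"
proof -
  have sub: "M \<subseteq> M'"
    if "M \<subseteq> edges (complete_graph k \<box> complete_graph 2)"
      and eq: "split_matching k M = split_matching k M'" for M M'
  proof
    fix e assume eM: "e \<in> M"
    then have "e \<in> edges (complete_graph k \<box> complete_graph 2)"
      using that by blast
    then show "e \<in> M'"
    proof (cases rule: prism_edge_cases)
      case (rung v)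
      then show ?thesis using eq eM by (auto simp: split_matching_def)
    next
      case (level i d)
      then have "i = 0 \<or> i = 1" by auto
      then show ?thesis using eq eM level by (auto simp: split_matching_def)
    qed
  qed
  show ?thesis
  proof (rule inj_onI)
    fix M M'
    assume "M \<in> {M. perfect_matching (complete_graph k \<box> complete_graph 2) M}"
      "M' \<in> {M. perfect_matching (complete_graph k \<box> complete_graph 2) M}"
      and eq: "split_matching k M = split_matching k M'"
    then show "M = M'"
      using sub[of M M'] sub[of M' M] by (auto simp: perfect_matching_def)
  qed
qed

lemma sum_card_subsets:
  assumes "finite A"
  shows "(\<Sum>T\<in>Pow A. g (card T)) = (\<Sum>j\<le>card A. (card A choose j) * g j)"
proof -
  have "(\<Sum>T\<in>Pow A. g (card T)) = (\<Sum>j\<le>card A. \<Sum>T\<in>{T \<in> Pow A. card T = j}. g (card T))"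
    using assms by (intro sum.group[symmetric]) (auto intro: card_mono)
  also have "\<dots> = (\<Sum>j\<le>card A. (card A choose j) * g j)"
    using n_subsets[OF assms] by (intro sum.cong) (auto simp: Pow_def)
  finally show ?thesis .
qed

lemma matchings_prism_le:
  "\<Phi> (complete_graph k \<box> complete_graph 2) \<le> (\<Sum>j\<le>k. (k choose j) * pairings j ^ 2)"
proof -
  let ?B = "SIGMA T:Pow {..<k}. matchings_on T \<times> matchings_on T"
  have fin: "finite T" "finite (matchings_on T)" if "T \<subseteq> {..<k}" for T :: "nat set"
    using that finite_subset by (auto intro: finite_matchings_on)
  have "split_matching k ` {M. perfect_matching (complete_graph k \<box> complete_graph 2) M} \<subseteq> ?B"
    using perfect_matching_level[of k _ 0] perfect_matching_level[of k _ 1]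
    by (auto simp: split_matching_def)
  then have "\<Phi> (complete_graph k \<box> complete_graph 2) \<le> card ?B"
    unfolding num_perfect_matchings_def
    using fin by (intro card_inj_on_le[OF inj_on_split_matching]) auto
  also have "\<dots> = (\<Sum>T\<in>Pow {..<k}. card (matchings_on T) ^ 2)"
    using fin by (subst card_SigmaI) (auto simp: card_cartesian_product power2_eq_square)
  also have "\<dots> \<le> (\<Sum>T\<in>Pow {..<k}. pairings (card T) ^ 2)"
    using fin by (intro sum_mono power_mono card_matchings_on_le) auto
  also have "\<dots> = (\<Sum>j\<le>k. (k choose j) * pairings j ^ 2)"
    using sum_card_subsets[of "{..<k}" "\<lambda>j. pairings j ^ 2"] by simp
  finally show ?thesis .
qed

section \<open>The asymptotic bound\<close>

text \<open>This follows from \<open>k + 1 \<le> (j + 1) (k - j + 1)\<close> and the generous estimate \<open>j + 1 \<le> 4\<^sup>j\<close>, chosen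
  because its square root \<open>2\<^sup>j\<close> turns the sum over \<open>j\<close> into an exponential series.\<close>

lemma inverse_sqrt_split_le:
  assumes "j \<le> k"
  shows "1 / sqrt (real (k - j) + 1) \<le> 2 ^ j / sqrt (real k + 1)"
proof -
  have "real k + 1 \<le> (real j + 1) * (real (k - j) + 1)"
    using assms by (simp add: of_nat_diff algebra_simps mult_left_mono)
  also have "\<dots> \<le> (2 ^ j) ^ 2 * (real (k - j) + 1)"
  proof (intro mult_right_mono)
    have "Suc j \<le> 2 ^ j"
      by (simp add: Suc_leI)
    then have "real j + 1 \<le> 2 ^ j"
      by (metis Suc_eq_plus1 of_nat_Suc of_nat_le_iff of_nat_numeral of_nat_power add.commute)
    also have "(2::real) ^ j \<le> (2 ^ j) ^ 2"
      by (simp add: power2_eq_square)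
    finally show "real j + 1 \<le> (2 ^ j) ^ 2" .
  qed simp
  finally have "sqrt (real k + 1) \<le> sqrt ((2 ^ j) ^ 2 * (real (k - j) + 1))"
    by (rule real_sqrt_le_mono)
  also have "\<dots> = 2 ^ j * sqrt (real (k - j) + 1)"
    by (simp only: real_sqrt_mult real_sqrt_abs) simp
  finally show ?thesis
    by (simp add: field_simps)
qed

lemma matchings_prism_le_fact:
  "real (\<Phi> (complete_graph k \<box> complete_graph 2)) \<le> exp 2 / sqrt (real k + 1) * fact k"
proof -
  have "real (\<Phi> (complete_graph k \<box> complete_graph 2))
      \<le> real (\<Sum>j\<le>k. (k choose j) * pairings j ^ 2)"
    using matchings_prism_le of_nat_le_iff by blast
  also have "\<dots> = (\<Sum>j\<le>k. real (k choose j) * real (pairings j) ^ 2)"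
    by simp
  also have "\<dots> = (\<Sum>j\<le>k. real (k choose j) * real (pairings (k - j)) ^ 2)"
    by (subst sum.nat_diff_reindex[symmetric, where n = "Suc k", unfolded lessThan_Suc_atMost])
      (auto simp: binomial_symmetric[symmetric] intro!: sum.cong)
  also have "\<dots> \<le> (\<Sum>j\<le>k. fact k / sqrt (real k + 1) * (2 ^ j / fact j))"
  proof (intro sum_mono)
    fix j assume "j \<in> {..k}"
    then have j: "j \<le> k" by simp
    have "real (k choose j) * real (pairings (k - j)) ^ 2
        \<le> real (k choose j) * (fact (k - j) / sqrt (real (k - j) + 1))"
      by (intro mult_left_mono pairings_sq_le) simp
    also have "\<dots> = fact k / fact j * (1 / sqrt (real (k - j) + 1))"
      by (simp add: binomial_fact[OF j])
    also have "\<dots> \<le> fact k / fact j * (2 ^ j / sqrt (real k + 1))"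
      by (intro mult_left_mono inverse_sqrt_split_le j) simp
    finally show "real (k choose j) * real (pairings (k - j)) ^ 2
        \<le> fact k / sqrt (real k + 1) * (2 ^ j / fact j)"
      by (simp add: field_simps)
  qed
  also have "\<dots> = fact k / sqrt (real k + 1) * (\<Sum>j\<le>k. 2 ^ j / fact j)"
    by (simp add: sum_distrib_left)
  also have "\<dots> \<le> fact k / sqrt (real k + 1) * exp 2"
  proof (intro mult_left_mono)
    have "(\<lambda>j. 2 ^ j / fact j) sums exp (2::real)"
      using exp_converges[of "2::real"] by (simp add: divide_inverse mult.commute)
    then show "(\<Sum>j\<le>k. 2 ^ j / fact j) \<le> exp (2::real)"
      by (metis (no_types, lifting) finite_atMost sum_le_suminf sums_iff
          divide_nonneg_pos fact_gt_zero zero_le_numeral zero_le_power)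
  qed simp
  finally show ?thesis by (simp add: mult.commute)
qed

theorem proposition6:
  fixes \<epsilon> :: real
  assumes "\<epsilon> > 0"
  shows "\<exists>k0 :: nat. \<forall>k \<ge> k0.
           real (\<Phi> (complete_graph k \<box> complete_graph 2)) < \<epsilon> * fact k"
proof -
  obtain k0 :: nat where k0: "(exp 2 / \<epsilon>) ^ 2 < real k0"
    using reals_Archimedean2 by blast
  show ?thesis
  proof (intro exI[of _ k0] allI impI)
    fix k assume "k0 \<le> k"
    with k0 have "(exp 2 / \<epsilon>) ^ 2 < real k + 1" by linarith
    then have "exp 2 / \<epsilon> < sqrt (real k + 1)"
      by (rule real_less_rsqrt)
    then have "exp 2 / sqrt (real k + 1) < \<epsilon>"
      using assms by (simp add: field_simps)
    then have "exp 2 / sqrt (real k + 1) * fact k < \<epsilon> * fact k"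
      by (intro mult_strict_right_mono) simp_all
    with matchings_prism_le_fact[of k]
    show "real (\<Phi> (complete_graph k \<box> complete_graph 2)) < \<epsilon> * fact k"
      by linarith
  qed
qed

end
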